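(* Let $M\in\mathbb{R}^{n\times d}$ and let $\sigma:[d]\dashrightarrow[n]$ be a partial bijection. The following are equivalent: (i) $\sigma$ is permanent-attaining with respect to $M$; (ii) $\sigma$ is satisfiable with respect to $M$; (iii) there exists $y\in\mathrm{Col}_\oplus(M)$ that satisfies $\sigma$.
   Context: $[n]=\{1,\dots,n\}$. $\mathbb{B}^{n\times d}$ is the set of $n\times d$ Boolean matrices with entrywise order $\preceq$. For $a,y\in\mathbb{R}^n$, $\mathrm{Dom}_i(a)=\{y: y_i-a_i=\min_k(y_k-a_k)\}$. For $S\in\mathbb{B}^{n\times d}$, a point $x\in\mathbb{R}^n$ satisfies $S$ (with respect to $M$, with columns $M_{\star j}$) if $x\in\mathrm{Dom}_i(M_{\star j})$ for all $(i,j)$ with $S_{ij}=1$; $S$ is satisfiable if some point satisfies it. A partial bijection $\sigma:[d]\dashrightarrow[n]$ is a bijection $\sigma:J\to I$ with $J\subseteq[d]$, $I\subseteq[n]$, identified with $\Sigma\in\mathbb{B}^{n\times d}$, $\Sigma_{ij}=1$ iff $j\in J$ and $i=\sigma(j)$; satisfiability of $\sigma$ means satisfiability of $\Sigma$. $\sigma$ is permanent-attaining with respect to $M$ if $\sum_{j\in J}M_{\sigma(j),j}\ge\sum_{j\in J}M_{\tau(j),j}$ for every bijection $\tau:J\to I$. $\mathrm{Col}_\oplus(M)$ is the max-plus column space of $M$: the set of vectors $\max_{j}(\lambda_j+M_{\star j})$ (componentwise maximum) over all $\lambda_1,\dots,\lambda_d\in\mathbb{R}$. *)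

theory Defs
  imports "HOL-Analysis.Analysis"
begin

(* An n x d matrix M is a value of type real^'d^'n, with entry M_ij written M $ i $ j;
   the finite, nonempty index types 'n and 'd stand for [n] and [d] with n, d >= 1. *)

definition Dom :: "'n::finite \<Rightarrow> real^'n \<Rightarrow> (real^'n) set" where
  "Dom i a = {y. y $ i - a $ i = Min (range (\<lambda>k. y $ k - a $ k))}"

definition satisfies :: "real^'d^'n \<Rightarrow> real^'n \<Rightarrow> bool^'d^'n \<Rightarrow> bool" where
  "satisfies M x S \<longleftrightarrow> (\<forall>i j. S $ i $ j \<longrightarrow> x \<in> Dom i (column j M))"

definition satisfiable :: "real^'d^'n \<Rightarrow> bool^'d^'n \<Rightarrow> bool" where
  "satisfiable M S \<longleftrightarrow> (\<exists>x. satisfies M x S)"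

(* A partial bijection from [d] to [n] is given by J, I and a function \<sigma> with
   bij_betw \<sigma> J I; the values of \<sigma> outside J are never used. *)

definition pbij_matrix :: "'d set \<Rightarrow> ('d \<Rightarrow> 'n) \<Rightarrow> bool^'d^'n" where
  "pbij_matrix J \<sigma> = (\<chi> i j. j \<in> J \<and> i = \<sigma> j)"

definition permanent_attaining ::
    "real^'d^'n \<Rightarrow> 'd set \<Rightarrow> 'n set \<Rightarrow> ('d \<Rightarrow> 'n) \<Rightarrow> bool" where
  "permanent_attaining M J I \<sigma> \<longleftrightarrow>
     (\<forall>\<tau>. bij_betw \<tau> J I \<longrightarrow> (\<Sum>j\<in>J. M $ \<tau> j $ j) \<le> (\<Sum>j\<in>J. M $ \<sigma> j $ j))"

definition max_plus_column_space :: "real^'d::finite^'n \<Rightarrow> (real^'n) set" where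
  "max_plus_column_space M =
     range (\<lambda>l :: real^'d. \<chi> i. Max (range (\<lambda>j. l $ j + column j M $ i)))"

end

theory Submission
  imports Defs "HOL-Combinatorics.Cycles"
begin

text \<open>
  Satisfying \<open>\<sigma>\<close> means \<open>y (\<sigma> j) + w (\<sigma> j) k \<le> y k\<close> for the edge weights
  \<open>w (\<sigma> j) k = M k j - M (\<sigma> j) j\<close>, so \<open>y\<close> is a potential for a weighted digraph.
  A potential exists iff no cycle has positive weight, and since all edges start in \<open>I\<close>, the
  cycles live in \<open>I\<close> and extend to permutations of \<open>I\<close>; these have nonpositive weight exactly when
  \<open>\<sigma>\<close> attains the permanent. The potential itself is the largest weight of a simple path
  ending at the given vertex. Finally, projecting a satisfying point onto the column space keeps
  the coordinates in \<open>I\<close> and preserves all the inequalities.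
\<close>

text \<open>A walk is given by its list of vertices. Zipping with the tail pairs each vertex with
  its successor, so a single vertex weighs 0.\<close>

definition walk_weight :: "('a \<Rightarrow> 'a \<Rightarrow> real) \<Rightarrow> 'a list \<Rightarrow> real" where
  "walk_weight w xs = sum_list (map2 w xs (tl xs))"

lemma walk_weight_append:
  "walk_weight w (us @ b # vs) = walk_weight w (us @ [b]) + walk_weight w (b # vs)"
proof (induction us)
  case Nil
  then show ?case by (simp add: walk_weight_def)
next
  case (Cons u us)
  then show ?case by (cases us) (simp_all add: walk_weight_def)
qed

text \<open>Passes from closed walks to permutations: rotating a distinct list by one moves each
  entry to its image under the cycle.\<close>

lemma walk_weight_cycle:
  assumes "distinct cs" "cs \<noteq> []"
  shows "walk_weight w (cs @ [hd cs]) = (\<Sum>x\<in>set cs. w x (cycle_of_list cs x))"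
proof -
  have tl: "tl (cs @ [hd cs]) = rotate1 cs"
    using assms(2) by (cases cs) auto
  have rot: "rotate1 cs = map (cycle_of_list cs) cs"
    using cyclic_rotation[OF assms(1), of 1] by simp
  have "walk_weight w (cs @ [hd cs]) = sum_list (map2 w (cs @ [hd cs]) (rotate1 cs))"
    by (simp only: walk_weight_def tl)
  also have "zip (cs @ [hd cs]) (rotate1 cs) = zip cs (rotate1 cs)"
    by (subst zip_append1) simp
  also have "map2 w cs (rotate1 cs) = map (\<lambda>x. w x (cycle_of_list cs x)) cs"
    unfolding rot using map2_map_map[of w "\<lambda>x. x" cs "cycle_of_list cs"] by simp
  also have "sum_list \<dots> = (\<Sum>x\<in>set cs. w x (cycle_of_list cs x))"
    using assms(1) by (rule sum_list_distinct_conv_sum_set)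
  finally show ?thesis .
qed

lemma potential_exists:
  fixes w :: "'a \<Rightarrow> 'a \<Rightarrow> real"
  assumes "finite A"
    and loop: "\<And>a. a \<in> A \<Longrightarrow> w a a = 0"
    and perm: "\<And>p. p permutes A \<Longrightarrow> (\<Sum>a\<in>A. w a (p a)) \<le> 0"
  obtains y where "\<And>a k. a \<in> A \<Longrightarrow> y a + w a k \<le> y k"
proof
  \<comment> \<open>The vertices before the endpoint \<open>k\<close> of a simple path. They lie in
    \<open>A\<close>, while \<open>k\<close> is arbitrary; \<open>[]\<close> always qualifies, so
    the maximum exists.\<close>
  define P where "P k = {us. distinct (us @ [k]) \<and> set us \<subseteq> A}" for k
  define y where "y k = Max ((\<lambda>us. walk_weight w (us @ [k])) ` P k)" for k
  have fin: "finite (P k)" for k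
    by (rule finite_subset[OF _ finite_subset_distinct[OF assms(1)]]) (auto simp: P_def)
  have ne: "P k \<noteq> {}" for k
    by (auto simp: P_def intro!: exI[of _ "[]"])
  have upper: "walk_weight w (us @ [k]) \<le> y k" if "us \<in> P k" for us k
    using that fin by (auto simp: y_def)
  have cycle: "walk_weight w (cs @ [hd cs]) \<le> 0"
    if d: "distinct cs" and sub: "set cs \<subseteq> A" and "cs \<noteq> []" for cs
  proof -
    \<comment> \<open>Points outside the cycle are fixed by it and contribute loops, which weigh
      0.\<close>
    have "(\<Sum>x\<in>set cs. w x (cycle_of_list cs x)) = (\<Sum>x\<in>A. w x (cycle_of_list cs x))"
      using assms(1) sub loop
      by (intro sum.mono_neutral_left) (auto simp: id_outside_supp)
    also have "\<dots> \<le> 0"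
      using permutes_subset[OF cycle_permutes sub] by (rule perm)
    finally show ?thesis
      using walk_weight_cycle[OF d \<open>cs \<noteq> []\<close>] by simp
  qed
  fix a k
  assume "a \<in> A"
  have "y a \<in> (\<lambda>us. walk_weight w (us @ [a])) ` P a"
    unfolding y_def using fin ne by (intro Max_in) auto
  then obtain us where us: "us \<in> P a" and y: "y a = walk_weight w (us @ [a])"
    by blast
  let ?xs = "us @ [a]"
  have xs: "distinct ?xs" "set ?xs \<subseteq> A"
    using us \<open>a \<in> A\<close> by (auto simp: P_def)
  have "y a + w a k = walk_weight w (?xs @ [k])"
    using walk_weight_append[of w us a "[k]"] by (simp add: y walk_weight_def)
  also have "\<dots> \<le> y k"
  proof (cases "k \<in> set ?xs")
    case False
    then show ?thesis using xs by (intro upper) (auto simp: P_def)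
  next
    \<comment> \<open>Appending \<open>k\<close> now closes a cycle. Cutting it off leaves a simple
      path to \<open>k\<close> and loses only a nonpositive weight.\<close>
    case True
    then obtain vs ws where split: "?xs = vs @ k # ws" by (meson split_list)
    have "walk_weight w (?xs @ [k]) = walk_weight w (vs @ [k]) + walk_weight w (k # ws @ [k])"
      unfolding split using walk_weight_append[of w vs k "ws @ [k]"] by simp
    moreover have "walk_weight w (vs @ [k]) \<le> y k"
      using xs unfolding split by (intro upper) (auto simp: P_def)
    moreover have "walk_weight w (k # ws @ [k]) \<le> 0"
      using cycle[of "k # ws"] xs unfolding split by simp
    ultimately show ?thesis by linarith
  qed
  finally show "y a + w a k \<le> y k" .
qed

lemma Dom_iff: "y \<in> Dom i a \<longleftrightarrow> (\<forall>k. y $ i - a $ i \<le> y $ k - a $ k)"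
proof -
  have "y \<in> Dom i a \<longleftrightarrow> Min (range (\<lambda>k. y $ k - a $ k)) = y $ i - a $ i"
    unfolding Dom_def by (simp add: eq_commute)
  also have "\<dots> \<longleftrightarrow> (\<forall>k. y $ i - a $ i \<le> y $ k - a $ k)"
    by (subst Min_eq_iff) auto
  finally show ?thesis .
qed

lemma satisfies_pbij_matrix_iff:
  "satisfies M y (pbij_matrix J \<sigma>) \<longleftrightarrow>
    (\<forall>j\<in>J. \<forall>k. y $ \<sigma> j - M $ \<sigma> j $ j \<le> y $ k - M $ k $ j)"
  by (auto simp: satisfies_def pbij_matrix_def Dom_iff column_def)

text \<open>Take the inequality for column \<open>j\<close> at row \<open>\<tau> j\<close> and sum
  over \<open>J\<close>: the \<open>y\<close> terms cancel, as both bijections run through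
  \<open>I\<close>.\<close>

lemma satisfies_imp_permanent_attaining:
  assumes \<sigma>: "bij_betw \<sigma> J I" and y: "satisfies M y (pbij_matrix J \<sigma>)"
  shows "permanent_attaining M J I \<sigma>"
  unfolding permanent_attaining_def
proof (intro allI impI)
  fix \<tau>
  assume \<tau>: "bij_betw \<tau> J I"
  have "(\<Sum>j\<in>J. y $ \<sigma> j - M $ \<sigma> j $ j) \<le> (\<Sum>j\<in>J. y $ \<tau> j - M $ \<tau> j $ j)"
    using y by (intro sum_mono) (simp add: satisfies_pbij_matrix_iff)
  moreover have "(\<Sum>j\<in>J. y $ \<tau> j) = (\<Sum>j\<in>J. y $ \<sigma> j)"
    using sum.reindex_bij_betw[OF \<sigma>, of "($) y"] sum.reindex_bij_betw[OF \<tau>, of "($) y"] by simp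
  ultimately show "(\<Sum>j\<in>J. M $ \<tau> j $ j) \<le> (\<Sum>j\<in>J. M $ \<sigma> j $ j)"
    by (simp add: sum_subtractf)
qed

lemma permanent_attaining_imp_satisfiable:
  fixes M :: "real^'d^'n"
  assumes \<sigma>: "bij_betw \<sigma> J I" and perm: "permanent_attaining M J I \<sigma>"
  shows "satisfiable M (pbij_matrix J \<sigma>)"
proof -
  define g where "g = inv_into J \<sigma>"
  have g: "g (\<sigma> j) = j" if "j \<in> J" for j
    using that \<sigma> by (simp add: g_def bij_betw_inv_into_left)
  \<comment> \<open>For \<open>a = \<sigma> j\<close> the map \<open>g\<close> recovers the column
    \<open>j\<close>, so the potential inequality becomes the dominance condition for that
    column.\<close>
  define w where "w a k = M $ k $ g a - M $ a $ g a" for a k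
  have "(\<Sum>a\<in>I. w a (p a)) \<le> 0" if "p permutes I" for p
  proof -
    \<comment> \<open>Permuting the rows in \<open>I\<close> gives the competitor of
      \<open>\<sigma>\<close> in the permanent.\<close>
    have "bij_betw (p \<circ> \<sigma>) J I"
      using \<sigma> permutes_imp_bij[OF that] by (rule bij_betw_trans)
    then have "(\<Sum>j\<in>J. M $ p (\<sigma> j) $ j) \<le> (\<Sum>j\<in>J. M $ \<sigma> j $ j)"
      using perm unfolding permanent_attaining_def comp_def by blast
    moreover have "(\<Sum>a\<in>I. w a (p a)) = (\<Sum>j\<in>J. w (\<sigma> j) (p (\<sigma> j)))"
      by (rule sum.reindex_bij_betw[OF \<sigma>, symmetric])
    moreover have "\<dots> = (\<Sum>j\<in>J. M $ p (\<sigma> j) $ j - M $ \<sigma> j $ j)"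
      by (intro sum.cong) (simp_all add: w_def g)
    ultimately show ?thesis by (simp add: sum_subtractf)
  qed
  then obtain y where y: "\<And>a k. a \<in> I \<Longrightarrow> y a + w a k \<le> y k"
    using potential_exists[of I w] by (auto simp: w_def)
  have "satisfies M (\<chi> k. y k) (pbij_matrix J \<sigma>)"
    unfolding satisfies_pbij_matrix_iff
  proof (intro ballI allI)
    fix j k
    assume "j \<in> J"
    then show "(\<chi> k. y k) $ \<sigma> j - M $ \<sigma> j $ j \<le> (\<chi> k. y k) $ k - M $ k $ j"
      using y[of "\<sigma> j" k] bij_betw_apply[OF \<sigma>] by (simp add: w_def g)
  qed
  then show ?thesis unfolding satisfiable_def by blast
qed

lemma satisfies_imp_satisfies_column_space:
  fixes M :: "real^'d^'n"
  assumes x: "satisfies M x (pbij_matrix J \<sigma>)"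
  obtains y where "y \<in> max_plus_column_space M" "satisfies M y (pbij_matrix J \<sigma>)"
proof
  \<comment> \<open>The largest coefficients keeping every shifted column below \<open>x\<close>;
    the resulting \<open>y\<close> is the largest point of the column space below
    \<open>x\<close>.\<close>
  define l :: "real^'d" where "l = (\<chi> j. Min (range (\<lambda>k. x $ k - M $ k $ j)))"
  define y :: "real^'n" where "y = (\<chi> i. Max (range (\<lambda>j. l $ j + column j M $ i)))"
  show "y \<in> max_plus_column_space M"
    by (simp add: max_plus_column_space_def y_def)
  have l_le: "l $ j \<le> x $ k - M $ k $ j" for j k
    by (simp add: l_def)
  have le_y: "l $ j + M $ k $ j \<le> y $ k" for j k
    by (simp add: y_def column_def)
  have y_le: "y $ k \<le> x $ k" for k
    using l_le[of _ k] by (simp add: y_def column_def algebra_simps)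
  \<comment> \<open>As \<open>x\<close> satisfies \<open>\<sigma>\<close>, the minimum defining
    \<open>l $ j\<close> is attained at row \<open>\<sigma> j\<close>.\<close>
  have l_eq: "x $ \<sigma> j - M $ \<sigma> j $ j \<le> l $ j" if "j \<in> J" for j
    using x that by (simp add: l_def satisfies_pbij_matrix_iff)
  show "satisfies M y (pbij_matrix J \<sigma>)"
    unfolding satisfies_pbij_matrix_iff
  proof (intro ballI allI)
    fix j k
    assume "j \<in> J"
    then show "y $ \<sigma> j - M $ \<sigma> j $ j \<le> y $ k - M $ k $ j"
      using l_eq[of j] y_le[of "\<sigma> j"] le_y[of j k] by linarith
  qed
qed

theorem theorem5p2:
  fixes M :: "real^'d^'n"
    and J :: "'d set" and I :: "'n set" and \<sigma> :: "'d \<Rightarrow> 'n"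
  assumes "bij_betw \<sigma> J I"
  shows "(permanent_attaining M J I \<sigma> \<longleftrightarrow> satisfiable M (pbij_matrix J \<sigma>)) \<and>
         (satisfiable M (pbij_matrix J \<sigma>) \<longleftrightarrow>
           (\<exists>y \<in> max_plus_column_space M. satisfies M y (pbij_matrix J \<sigma>)))"
proof (intro conjI iffI)
  assume "permanent_attaining M J I \<sigma>"
  then show "satisfiable M (pbij_matrix J \<sigma>)"
    by (rule permanent_attaining_imp_satisfiable[OF assms])
next
  assume "satisfiable M (pbij_matrix J \<sigma>)"
  then show "permanent_attaining M J I \<sigma>"
    unfolding satisfiable_def using satisfies_imp_permanent_attaining[OF assms] by blast
next
  assume "satisfiable M (pbij_matrix J \<sigma>)"
  then show "\<exists>y \<in> max_plus_column_space M. satisfies M y (pbij_matrix J \<sigma>)"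
    unfolding satisfiable_def by (blast elim: satisfies_imp_satisfies_column_space)
next
  assume "\<exists>y \<in> max_plus_column_space M. satisfies M y (pbij_matrix J \<sigma>)"
  then show "satisfiable M (pbij_matrix J \<sigma>)"
    unfolding satisfiable_def by blast
qed

end
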